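(* Let $(A,[-,-])$ be a Maltsev algebra over $\mathbf{k}$ and $\alpha\colon A\to A$ be an algebra morphism. Then the Hom-algebra $A_\alpha=(A,\;[-,-]_\alpha=\alpha\circ[-,-],\;\alpha)$ induced by $\alpha$ is a Hom-Maltsev algebra.
   Context: $\mathbf{k}$ is a fixed field of characteristic $0$; all modules, linear maps and tensor products are over $\mathbf{k}$. A Maltsev algebra is a $\mathbf{k}$-module $A$ with an anti-symmetric bilinear multiplication $[-,-]$ satisfying $J(x,y,[x,z])=[J(x,y,z),x]$ for all $x,y,z$, where $J(x,y,z)=[[x,y],z]+[[z,x],y]+[[y,z],x]$. An algebra morphism is a linear map $\alpha$ with $\alpha([x,y])=[\alpha(x),\alpha(y)]$. A Hom-algebra is a triple $(B,\mu,\alpha)$ with $B$ a $\mathbf{k}$-module, $\mu\colon B\otimes B\to B$ bilinear, and $\alpha\colon B\to B$ linear with $\alpha(\mu(x,y))=\mu(\alpha(x),\alpha(y))$ for all $x,y$. For a Hom-algebra $(B,[-,-],\alpha)$, the Hom-Jacobian is $J_B(x,y,z)=[[x,y],\alpha(z)]+[[z,x],\alpha(y)]+[[y,z],\alpha(x)]$. A Hom-Maltsev algebra is a Hom-algebra $(B,[-,-],\alpha)$ with $[-,-]$ anti-symmetric and satisfying $J_B(\alpha(x),\alpha(y),[x,z])=[J_B(x,y,z),\alpha^2(x)]$ for all $x,y,z\in B$. *)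

theory Defs
  imports Complex_Main
begin

text \<open>
  The ground field of characteristic 0 is a type of class \<^class>\<open>field_char_0\<close>, and a module over it
  is a type of class \<^class>\<open>ab_group_add\<close> together with a scalar multiplication that forms a
  \<^locale>\<open>vector_space\<close>. A linear map on the tensor square of a module is given as a curried
  bilinear map.
\<close>

locale algebra_over = vector_space scale
  for scale :: "'k::field_char_0 \<Rightarrow> 'a::ab_group_add \<Rightarrow> 'a" +
  fixes mult :: "'a \<Rightarrow> 'a \<Rightarrow> 'a"
  assumes linear_mult_left: "Vector_Spaces.linear scale scale (\<lambda>x. mult x y)"
    and linear_mult_right: "Vector_Spaces.linear scale scale (\<lambda>y. mult x y)"

definition antisymmetric_mult :: "('a \<Rightarrow> 'a \<Rightarrow> 'a::ab_group_add) \<Rightarrow> bool" where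
  "antisymmetric_mult br \<longleftrightarrow> (\<forall>x y. br x y = - br y x)"

definition jacobian :: "('a \<Rightarrow> 'a \<Rightarrow> 'a::ab_group_add) \<Rightarrow> 'a \<Rightarrow> 'a \<Rightarrow> 'a \<Rightarrow> 'a" where
  "jacobian br x y z = br (br x y) z + br (br z x) y + br (br y z) x"

locale maltsev_algebra = algebra_over scale br
  for scale :: "'k::field_char_0 \<Rightarrow> 'a::ab_group_add \<Rightarrow> 'a" and br :: "'a \<Rightarrow> 'a \<Rightarrow> 'a" +
  assumes antisymmetric: "antisymmetric_mult br"
    and maltsev_identity: "jacobian br x y (br x z) = br (jacobian br x y z) x"

locale algebra_morphism =
  source: algebra_over scaleA multA + target: algebra_over scaleB multB +
  Vector_Spaces.linear scaleA scaleB f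
  for scaleA :: "'k::field_char_0 \<Rightarrow> 'a::ab_group_add \<Rightarrow> 'a" and multA :: "'a \<Rightarrow> 'a \<Rightarrow> 'a"
    and scaleB :: "'k \<Rightarrow> 'b::ab_group_add \<Rightarrow> 'b" and multB :: "'b \<Rightarrow> 'b \<Rightarrow> 'b"
    and f :: "'a \<Rightarrow> 'b" +
  assumes preserves_mult: "f (multA x y) = multB (f x) (f y)"

locale hom_algebra = algebra_over scale mult
  for scale :: "'k::field_char_0 \<Rightarrow> 'a::ab_group_add \<Rightarrow> 'a" and mult :: "'a \<Rightarrow> 'a \<Rightarrow> 'a" +
  fixes \<alpha> :: "'a \<Rightarrow> 'a"
  assumes linear_twist: "Vector_Spaces.linear scale scale \<alpha>"
    and multiplicative: "\<alpha> (mult x y) = mult (\<alpha> x) (\<alpha> y)"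

definition hom_jacobian ::
  "('a \<Rightarrow> 'a \<Rightarrow> 'a::ab_group_add) \<Rightarrow> ('a \<Rightarrow> 'a) \<Rightarrow> 'a \<Rightarrow> 'a \<Rightarrow> 'a \<Rightarrow> 'a" where
  "hom_jacobian br \<alpha> x y z = br (br x y) (\<alpha> z) + br (br z x) (\<alpha> y) + br (br y z) (\<alpha> x)"

locale hom_maltsev_algebra = hom_algebra scale br \<alpha>
  for scale :: "'k::field_char_0 \<Rightarrow> 'a::ab_group_add \<Rightarrow> 'a"
    and br :: "'a \<Rightarrow> 'a \<Rightarrow> 'a" and \<alpha> :: "'a \<Rightarrow> 'a" +
  assumes antisymmetric: "antisymmetric_mult br"
    and hom_maltsev_identity:
      "hom_jacobian br \<alpha> (\<alpha> x) (\<alpha> y) (br x z) = br (hom_jacobian br \<alpha> x y z) ((\<alpha> ^^ 2) x)"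

definition induced_mult :: "('a \<Rightarrow> 'a \<Rightarrow> 'a) \<Rightarrow> ('a \<Rightarrow> 'a) \<Rightarrow> 'a \<Rightarrow> 'a \<Rightarrow> 'a" where
  "induced_mult mult \<alpha> x y = \<alpha> (mult x y)"

end

theory Submission
  imports Defs
begin

text \<open>
  Every term of the Jacobian is a twofold product. Twisting the multiplication by a multiplicative
  map \<open>\<alpha>\<close> puts one \<open>\<alpha>\<close> around each of the two products, and the inner one can be
  pulled out because the Hom-Jacobian also applies \<open>\<alpha>\<close> to the third factor. So the
  Hom-Jacobian of the induced algebra is \<open>\<alpha>\<^sup>2\<close> of the original Jacobian
  (\<open>hom_jacobian_induced_mult\<close>). Both sides of the Hom-Maltsev identity are then
  \<open>\<alpha>\<^sup>3\<close> of the corresponding sides of the Maltsev identity.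
\<close>

lemma algebra_over_induced_mult:
  assumes "algebra_over scale mult" and "Vector_Spaces.linear scale scale \<alpha>"
  shows "algebra_over scale (induced_mult mult \<alpha>)"
proof -
  interpret algebra_over scale mult by fact
  show ?thesis
  proof (intro algebra_over.intro algebra_over_axioms.intro)
    show "vector_space scale" by unfold_locales
    show "Vector_Spaces.linear scale scale (\<lambda>x. induced_mult mult \<alpha> x y)" for y
      using Vector_Spaces.linear_compose[OF linear_mult_left assms(2)] by (simp add: induced_mult_def o_def)
    show "Vector_Spaces.linear scale scale (\<lambda>y. induced_mult mult \<alpha> x y)" for x
      using Vector_Spaces.linear_compose[OF linear_mult_right assms(2)] by (simp add: induced_mult_def o_def)
  qed
qed

lemma jacobian_preserved:
  assumes "\<And>x y. \<alpha> (x + y) = \<alpha> x + \<alpha> y" and "\<And>x y. \<alpha> (mult x y) = mult (\<alpha> x) (\<alpha> y)"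
  shows "\<alpha> (jacobian mult x y z) = jacobian mult (\<alpha> x) (\<alpha> y) (\<alpha> z)"
  by (simp add: jacobian_def assms)

lemma hom_jacobian_induced_mult:
  assumes "\<And>x y. \<alpha> (x + y) = \<alpha> x + \<alpha> y" and "\<And>x y. \<alpha> (mult x y) = mult (\<alpha> x) (\<alpha> y)"
  shows "hom_jacobian (induced_mult mult \<alpha>) \<alpha> x y z = \<alpha> (\<alpha> (jacobian mult x y z))"
  by (simp add: hom_jacobian_def jacobian_def induced_mult_def assms)

theorem theorem2p13:
  fixes scale :: "'k::field_char_0 \<Rightarrow> 'a::ab_group_add \<Rightarrow> 'a"
    and br :: "'a \<Rightarrow> 'a \<Rightarrow> 'a"
    and \<alpha> :: "'a \<Rightarrow> 'a"
  assumes "maltsev_algebra scale br"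
    and "algebra_morphism scale br scale br \<alpha>"
  shows "hom_maltsev_algebra scale (induced_mult br \<alpha>) \<alpha>"
proof -
  interpret A: maltsev_algebra scale br by fact
  interpret \<alpha>: algebra_morphism scale br scale br \<alpha> by fact
  have lin: "Vector_Spaces.linear scale scale \<alpha>" by unfold_locales
  note hom_jac = hom_jacobian_induced_mult[of \<alpha> br, OF \<alpha>.add \<alpha>.preserves_mult]
  note jac = jacobian_preserved[of \<alpha> br, OF \<alpha>.add \<alpha>.preserves_mult]
  let ?m = "induced_mult br \<alpha>"
  interpret B: algebra_over scale ?m
    by (rule algebra_over_induced_mult[OF A.algebra_over_axioms lin])
  show ?thesis
  proof unfold_locales
    show "\<alpha> (?m x y) = ?m (\<alpha> x) (\<alpha> y)" for x y
      by (simp add: induced_mult_def \<alpha>.preserves_mult)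
    show "antisymmetric_mult ?m"
      using A.antisymmetric by (metis antisymmetric_mult_def induced_mult_def \<alpha>.neg)
    show "hom_jacobian ?m \<alpha> (\<alpha> x) (\<alpha> y) (?m x z) = ?m (hom_jacobian ?m \<alpha> x y z) ((\<alpha> ^^ 2) x)"
      for x y z
    proof -
      have "hom_jacobian ?m \<alpha> (\<alpha> x) (\<alpha> y) (?m x z) = \<alpha> (\<alpha> (\<alpha> (jacobian br x y (br x z))))"
        by (simp only: hom_jac jac induced_mult_def)
      also have "\<dots> = \<alpha> (\<alpha> (\<alpha> (br (jacobian br x y z) x)))"
        by (simp only: A.maltsev_identity)
      also have "\<dots> = ?m (hom_jacobian ?m \<alpha> x y z) ((\<alpha> ^^ 2) x)"
        by (simp add: hom_jac induced_mult_def \<alpha>.preserves_mult numeral_2_eq_2)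
      finally show ?thesis .
    qed
  qed
qed

end
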